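(* On agreeable instances, there is an $\mathcal{O}(1)$-competitive online algorithm for preemptive online machine minimization, and there is an $\mathcal{O}(1)$-competitive online algorithm for non-preemptive online machine minimization. That is, there is an absolute constant $C$ such that on every agreeable instance that admits a feasible schedule (preemptive, respectively non-preemptive) on $m$ machines, the algorithm produces a feasible schedule of the corresponding type on at most $C\cdot m$ machines.
   Context: An instance is a finite set of jobs $J$; each job $j$ has processing time $p_j\in\mathbb{N}$, release date $r_j\in\mathbb{N}$ and deadline $d_j\in\mathbb{N}$. A feasible schedule processes each job $j$ for $p_j$ time units within $[r_j,d_j)$; each machine processes at most one job at a time and no job runs on two machines simultaneously. In the preemptive setting jobs may be interrupted and resumed later on any machine; in the non-preemptive setting a job, once started, runs until completion on one machine. In the online problem, a job becomes known only at its release date; the algorithm may open machines over time with irrevocable decisions, and its cost is the total number of machines opened. An online algorithm is $c$-competitive if on every instance admitting a feasible schedule (of the respective type) on $m$ machines it produces a feasible schedule (of that type) on at most $c\cdot m$ machines. An instance is agreeable if for any two jobs $j,j'$, $r_j<r_{j'}$ implies $d_j\le d_{j'}$. *)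

theory Defs
  imports "HOL-Analysis.Analysis"
begin

text \<open>An instance is a finite set of jobs. The identifier only serves to let an instance contain
  several jobs with the same parameters; as every finite job set can be labelled with natural
  numbers, no generality is lost.\<close>

record job =
  job_id :: nat
  proc_time :: nat
  release :: nat
  deadline :: nat

definition agreeable :: "job set \<Rightarrow> bool" where
  "agreeable J \<longleftrightarrow> (\<forall>j\<in>J. \<forall>j'\<in>J. release j < release j' \<longrightarrow> deadline j \<le> deadline j')"

text \<open>Time is continuous. \<open>\<sigma> i t\<close> is the job (if any) run by machine \<open>i\<close> at time \<open>t\<close>; in particular,
  a machine runs at most one job at a time.\<close>

type_synonym schedule = "nat \<Rightarrow> real \<Rightarrow> job option"

definition processing_times :: "schedule \<Rightarrow> job \<Rightarrow> real set" where
  "processing_times \<sigma> j = {t. \<exists>i. \<sigma> i t = Some j}"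

text \<open>The fourth conjunct says that a job is interrupted only finitely often.\<close>

definition preemptive_schedule :: "job set \<Rightarrow> nat set \<Rightarrow> schedule \<Rightarrow> bool" where
  "preemptive_schedule J M \<sigma> \<longleftrightarrow>
     (\<forall>i t j. \<sigma> i t = Some j \<longrightarrow> i \<in> M \<and> j \<in> J) \<and>
     (\<forall>i i' t j. \<sigma> i t = Some j \<and> \<sigma> i' t = Some j \<longrightarrow> i = i') \<and>
     (\<forall>j\<in>J. processing_times \<sigma> j \<subseteq> {real (release j)..<real (deadline j)}) \<and>
     (\<forall>i. \<forall>j\<in>J. \<exists>F. finite F \<and> {t. \<sigma> i t = Some j} = (\<Union>(a, b)\<in>F. {a..<b})) \<and>
     (\<forall>j\<in>J. measure lborel (processing_times \<sigma> j) = real (proc_time j))"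

definition nonpreemptive_schedule :: "job set \<Rightarrow> nat set \<Rightarrow> schedule \<Rightarrow> bool" where
  "nonpreemptive_schedule J M \<sigma> \<longleftrightarrow>
     preemptive_schedule J M \<sigma> \<and>
     (\<forall>j\<in>J. \<exists>i s. \<forall>i' t. \<sigma> i' t = Some j \<longleftrightarrow> i' = i \<and> s \<le> t \<and> t < s + real (proc_time j))"

text \<open>A (deterministic) online algorithm decides, at each time \<open>t\<close> and from the jobs released up to
  and including \<open>t\<close> alone, which machines to open at \<open>t\<close> and which job each machine runs at \<open>t\<close>.
  Its earlier decisions are functions of the same data, hence need not be passed as an
  argument; they are irrevocable because the decisions at time \<open>t\<close> concern time \<open>t\<close> only, and
  machines, once opened, stay open.\<close>

type_synonym online_algorithm = "job set \<Rightarrow> real \<Rightarrow> nat set \<times> (nat \<Rightarrow> job option)"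

definition known_jobs :: "job set \<Rightarrow> real \<Rightarrow> job set" where
  "known_jobs J t = {j \<in> J. real (release j) \<le> t}"

definition open_machines :: "online_algorithm \<Rightarrow> job set \<Rightarrow> real \<Rightarrow> nat set" where
  "open_machines A J t = (\<Union>s\<in>{..t}. fst (A (known_jobs J s) s))"

definition all_opened :: "online_algorithm \<Rightarrow> job set \<Rightarrow> nat set" where
  "all_opened A J = (\<Union>t. open_machines A J t)"

definition schedule_of :: "online_algorithm \<Rightarrow> job set \<Rightarrow> schedule" where
  "schedule_of A J i t = snd (A (known_jobs J t) t) i"

text \<open>\<open>feas\<close> is the type of schedule (preemptive or non-preemptive), \<open>K\<close> the class of instances.\<close>

definition competitive_on ::
  "(job set \<Rightarrow> nat set \<Rightarrow> schedule \<Rightarrow> bool) \<Rightarrow> job set set \<Rightarrow> real \<Rightarrow> online_algorithm \<Rightarrow> bool" where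
  "competitive_on feas K c A \<longleftrightarrow>
     (\<forall>J\<in>K. \<forall>m::nat. (\<exists>\<sigma>. feas J {..<m} \<sigma>) \<longrightarrow>
        feas J (all_opened A J) (schedule_of A J) \<and>
        (\<forall>i t. schedule_of A J i t \<noteq> None \<longrightarrow> i \<in> open_machines A J t) \<and>
        finite (all_opened A J) \<and> real (card (all_opened A J)) \<le> c * real m)"

end

theory Submission
  imports Defs
begin

text \<open>A single non-preemptive algorithm is compared with the preemptive optimum. A tight job
  (\<open>16 p > d - r\<close>) runs in the middle of its window. A loose job is batched with the jobs whose
  window length has the same order of magnitude \<open>W\<close> (a power of two) and which are released in the
  same slot of length \<open>W\<close>; the batch is packed into a later slot that keeps a distance of order
  \<open>W\<close> to all releases and deadlines of the batch. Start times depend only on jobs known by then,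
  so first-fit colouring assigns machines online, and it remains to see that at every time \<open>O(m)\<close>
  jobs run. Agreeability forces the windows of the loose jobs running at \<open>t\<close> to have comparable
  lengths, and for the tight ones it bounds all laxities by the shortest distance from \<open>t\<close>
  to a window's end. In both cases the running jobs then compete for an interval that \<open>m\<close>
  machines can only fill with \<open>O(m)\<close> of them.\<close>

section \<open>The load bound\<close>

lemma measure_Ico_max:
  "measure lborel {a..<b::real} = max 0 (b - a)"
  by (cases "a \<le> b") auto

lemma Ico_fmeasurable: "{a..<b::real} \<in> fmeasurable lborel"
  by (intro fmeasurableI emeasure_bounded_finite) auto

text \<open>A job \<open>j\<close> runs for at most \<open>max 0 (x - r)\<close> units before \<open>x\<close> and for at most \<open>max 0 (d - y)\<close>
  units after \<open>y\<close>; the rest must fit into \<open>[x, y)\<close>.\<close>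

lemma work_bound:
  fixes x y :: real
  assumes feas: "preemptive_schedule J {..<m} \<sigma>" and "S \<subseteq> J" "finite S" "x \<le> y"
  shows "(\<Sum>j\<in>S. real (proc_time j) - max 0 (x - real (release j))
                   - max 0 (real (deadline j) - y)) \<le> real m * (y - x)"
proof -
  define T where "T i j = {t. \<sigma> i t = Some j}" for i j
  note feas_parts = feas[unfolded preemptive_schedule_def]
  note machine_range = feas_parts[THEN conjunct1]
    and windows = feas_parts[THEN conjunct2, THEN conjunct2, THEN conjunct1]
    and pieces = feas_parts[THEN conjunct2, THEN conjunct2, THEN conjunct2, THEN conjunct1]
    and amounts = feas_parts[THEN conjunct2, THEN conjunct2, THEN conjunct2, THEN conjunct2]
  have T_sets: "T i j \<in> sets lborel" if "j \<in> S" for i j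
  proof -
    obtain F where "finite F" "{t. \<sigma> i t = Some j} = (\<Union>(a, b)\<in>F. {a..<b})"
      using pieces \<open>j \<in> S\<close> \<open>S \<subseteq> J\<close> by (meson subsetD)
    then show ?thesis
      by (auto simp: T_def intro!: sets.finite_UN)
  qed
  \<comment> \<open>\<open>measure\<close> is 0 on sets of infinite measure, so monotonicity has to
    go through sets of finite measure.\<close>
  have T_fm: "T i j \<inter> {x..<y} \<in> fmeasurable lborel" if "j \<in> S" for i j
    by (rule fmeasurableI2[OF Ico_fmeasurable[of x y]]) (use T_sets[OF that] in auto)
  have P: "processing_times \<sigma> j = (\<Union>i<m. T i j)" for j
    using machine_range by (fastforce simp: processing_times_def T_def)
  have job: "real (proc_time j) - max 0 (x - real (release j)) - max 0 (real (deadline j) - y)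
      \<le> (\<Sum>i<m. measure lborel (T i j \<inter> {x..<y}))" if j: "j \<in> S" for j
  proof -
    let ?P = "processing_times \<sigma> j"
    let ?A = "{real (release j)..<x}" and ?B = "{y..<real (deadline j)}"
    have win: "?P \<subseteq> {real (release j)..<real (deadline j)}"
      and p: "measure lborel ?P = real (proc_time j)"
      using windows amounts j \<open>S \<subseteq> J\<close> by auto
    have Ps: "?P \<in> sets lborel"
      unfolding P using T_sets[OF j] by (intro sets.finite_UN) auto
    have PI: "?P \<inter> {x..<y} = (\<Union>i<m. T i j \<inter> {x..<y})"
      unfolding P by auto
    have fm: "?P \<inter> {x..<y} \<in> fmeasurable lborel"
      unfolding PI using T_fm[OF j] by (intro fmeasurable.finite_UN) auto
    have "measure lborel ?P \<le> measure lborel ((?P \<inter> {x..<y} \<union> ?A) \<union> ?B)"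
    proof (rule measure_mono_fmeasurable[OF _ Ps])
      show "?P \<subseteq> (?P \<inter> {x..<y} \<union> ?A) \<union> ?B" using win by auto
      show "(?P \<inter> {x..<y} \<union> ?A) \<union> ?B \<in> fmeasurable lborel"
        using fm Ico_fmeasurable by (intro fmeasurable.Un)
    qed
    also have "\<dots> \<le> measure lborel (?P \<inter> {x..<y} \<union> ?A) + measure lborel ?B"
      using Ps by (intro measure_Un_le) auto
    also have "\<dots> \<le> measure lborel (?P \<inter> {x..<y}) + measure lborel ?A + measure lborel ?B"
      using Ps by (intro add_right_mono measure_Un_le) auto
    also have "measure lborel (?P \<inter> {x..<y}) \<le> (\<Sum>i<m. measure lborel (T i j \<inter> {x..<y}))"
      unfolding PI using T_sets[OF j] by (intro measure_UNION_le) auto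
    finally show ?thesis
      by (simp add: p measure_Ico_max)
  qed
  \<comment> \<open>A machine runs one job at a time, so the sets of different jobs are disjoint and
    their measures add up.\<close>
  have machine: "(\<Sum>j\<in>S. measure lborel (T i j \<inter> {x..<y})) \<le> y - x" for i
  proof -
    have "(\<Sum>j\<in>S. measure lborel (T i j \<inter> {x..<y})) = measure lborel (\<Union>j\<in>S. T i j \<inter> {x..<y})"
      using \<open>finite S\<close> T_fm
      by (intro measure_UNION'[symmetric]) (auto simp: pairwise_def disjnt_def T_def)
    also have "\<dots> \<le> measure lborel {x..<y}"
    proof (rule measure_mono_fmeasurable)
      show "(\<Union>j\<in>S. T i j \<inter> {x..<y}) \<in> sets lborel"
        using \<open>finite S\<close> T_sets by (intro sets.finite_UN) auto
    qed (auto simp: Ico_fmeasurable)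
    finally show ?thesis using \<open>x \<le> y\<close> by simp
  qed
  have "(\<Sum>j\<in>S. real (proc_time j) - max 0 (x - real (release j)) - max 0 (real (deadline j) - y))
      \<le> (\<Sum>j\<in>S. \<Sum>i<m. measure lborel (T i j \<inter> {x..<y}))"
    by (intro sum_mono job)
  also have "\<dots> = (\<Sum>i<m. \<Sum>j\<in>S. measure lborel (T i j \<inter> {x..<y}))"
    by (rule sum.swap)
  also have "\<dots> \<le> (\<Sum>i<m. y - x)"
    by (intro sum_mono machine)
  finally show ?thesis by simp
qed

lemma card_work_bound:
  fixes x y c :: real
  assumes "preemptive_schedule J {..<m} \<sigma>" "S \<subseteq> J" "finite S" "x \<le> y"
    and "\<And>j. j \<in> S \<Longrightarrow> c \<le> real (proc_time j) - max 0 (x - real (release j))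
                            - max 0 (real (deadline j) - y)"
  shows "real (card S) * c \<le> real m * (y - x)"
proof -
  have "real (card S) * c \<le> (\<Sum>j\<in>S. real (proc_time j) - max 0 (x - real (release j))
                   - max 0 (real (deadline j) - y))"
    using sum_bounded_below[of S c] assms(5) by auto
  also have "\<dots> \<le> real m * (y - x)"
    by (rule work_bound[OF assms(1-4)])
  finally show ?thesis .
qed

text \<open>On the empty interval at the release date, the load bound says that \<open>p\<close> is
  at most \<open>max 0 (d - r)\<close>; \<open>p > 0\<close> excludes the value 0.\<close>

lemma feasible_window:
  assumes "preemptive_schedule J {..<m} \<sigma>" "j \<in> J" "0 < proc_time j"
  shows "release j + proc_time j \<le> deadline j"
  using work_bound[OF assms(1), of "{j}" "real (release j)" "real (release j)"] assms(2,3)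
  by (simp add: max_def split: if_splits)

section \<open>First-fit colouring of intervals\<close>

text \<open>An injective numbering that breaks ties independently of which other jobs are
  known.\<close>

definition code :: "job \<Rightarrow> nat" where
  "code j = prod_encode (job_id j, prod_encode (proc_time j, prod_encode (release j, deadline j)))"

lemma inj_code: "inj code"
  by (rule injI) (simp add: code_def)

definition start_before :: "job set \<Rightarrow> (job \<Rightarrow> real) \<Rightarrow> (job \<times> job) set" where
  "start_before J s = {(j', j). j' \<in> J \<and> j \<in> J \<and> (s j' < s j \<or> s j' = s j \<and> code j' < code j)}"

text \<open>First fit in order of start: the least colour not held by an earlier job that is still
  running.\<close>

definition color :: "job set \<Rightarrow> (job \<Rightarrow> real) \<Rightarrow> job \<Rightarrow> nat" where
  "color J s = wfrec (start_before J s)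
     (\<lambda>f j. LEAST c. \<forall>j'. (j', j) \<in> start_before J s \<and> s j < s j' + real (proc_time j') \<longrightarrow> c \<noteq> f j')"

lemma wf_start_before: "finite J \<Longrightarrow> wf (start_before J s)"
proof (rule finite_acyclic_wf)
  show "finite J \<Longrightarrow> finite (start_before J s)"
    by (rule finite_subset[of _ "J \<times> J"]) (auto simp: start_before_def)
  have "trans (start_before J s)"
    by (rule transI) (auto simp: start_before_def)
  then show "acyclic (start_before J s)"
    by (auto simp: acyclic_irrefl irrefl_def start_before_def)
qed

lemma color_unfold:
  assumes "finite J"
  shows "color J s j =
    (LEAST c. \<forall>j'. (j', j) \<in> start_before J s \<and> s j < s j' + real (proc_time j') \<longrightarrow> c \<noteq> color J s j')"
proof -
  have "color J s j = (LEAST c. \<forall>j'. (j', j) \<in> start_before J s \<and> s j < s j' + real (proc_time j')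
      \<longrightarrow> c \<noteq> cut (color J s) (start_before J s) j j')"
    unfolding color_def by (subst wfrec[OF wf_start_before[OF assms]]) simp
  also have "\<dots> = (LEAST c. \<forall>j'. (j', j) \<in> start_before J s \<and> s j < s j' + real (proc_time j')
      \<longrightarrow> c \<noteq> color J s j')"
    by (intro arg_cong[where f = Least] ext) (metis cut_apply)
  finally show ?thesis .
qed

text \<open>The recursion visits only predecessors in start order, and those of a job started by
  \<open>t\<close> have started by \<open>t\<close> too.\<close>

lemma color_cong:
  assumes "finite J" and K: "K = {j \<in> J. s j \<le> t}" and s: "\<And>j. j \<in> K \<Longrightarrow> s' j = s j"
    and "j \<in> K"
  shows "color K s' j = color J s j"
  using \<open>j \<in> K\<close>
proof (induction j rule: wf_induct_rule[OF wf_start_before[OF \<open>finite J\<close>, of s]])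
  case (1 j)
  have "finite K" using assms by simp
  have eq: "(j', j) \<in> start_before K s' \<longleftrightarrow> (j', j) \<in> start_before J s"
    and K': "(j', j) \<in> start_before J s \<Longrightarrow> j' \<in> K" for j'
    using 1(2) s by (auto simp: start_before_def K)
  have "((j', j) \<in> start_before K s' \<and> s' j < s' j' + real (proc_time j') \<longrightarrow> c \<noteq> color K s' j')
    \<longleftrightarrow> ((j', j) \<in> start_before J s \<and> s j < s j' + real (proc_time j') \<longrightarrow> c \<noteq> color J s j')" for c j'
    using eq K' 1 s by metis
  then show ?case
    unfolding color_unfold[OF \<open>finite K\<close>, of s' j] color_unfold[OF \<open>finite J\<close>, of s j]
    by (simp only:)
qed

text \<open>Pigeonhole: one of the \<open>card A + 1\<close> numbers up to \<open>card A\<close> is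
  not a value of \<open>f\<close> on \<open>A\<close>.\<close>

lemma least_unused_le_card:
  fixes f :: "'a \<Rightarrow> nat"
  assumes "finite A"
  shows "(LEAST c. \<forall>a. a \<in> A \<longrightarrow> c \<noteq> f a) \<le> card A"
    and "a \<in> A \<Longrightarrow> (LEAST c. \<forall>a. a \<in> A \<longrightarrow> c \<noteq> f a) \<noteq> f a"
proof -
  have "card (f ` A) < card {..card A}"
    using card_image_le[OF assms, of f] by simp
  then have "\<not> {..card A} \<subseteq> f ` A"
    using assms by (meson card_mono finite_imageI not_le)
  then obtain c where c: "c \<le> card A" "\<forall>a. a \<in> A \<longrightarrow> c \<noteq> f a" by blast
  show "(LEAST c. \<forall>a. a \<in> A \<longrightarrow> c \<noteq> f a) \<le> card A"
    using Least_le[of "\<lambda>c. \<forall>a. a \<in> A \<longrightarrow> c \<noteq> f a", OF c(2)] c(1) by (rule le_trans)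
  show "a \<in> A \<Longrightarrow> (LEAST c. \<forall>a. a \<in> A \<longrightarrow> c \<noteq> f a) \<noteq> f a"
    by (rule LeastI[of "\<lambda>c. \<forall>a. a \<in> A \<longrightarrow> c \<noteq> f a", OF c(2), THEN spec, THEN mp])
qed

definition running :: "job set \<Rightarrow> (job \<Rightarrow> real) \<Rightarrow> real \<Rightarrow> job set" where
  "running J s t = {j \<in> J. s j \<le> t \<and> t < s j + real (proc_time j)}"

text \<open>Of two jobs running at \<open>t\<close>, the earlier is still running when the later
  starts, so its colour is forbidden there.\<close>

lemma color_inj_on_running:
  assumes "finite J"
  shows "inj_on (color J s) (running J s t)"
proof -
  have ne: "color J s j \<noteq> color J s j'"
    if "j \<in> running J s t" "j' \<in> running J s t" "(j', j) \<in> start_before J s" for j j'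
  proof -
    let ?A = "{j'. (j', j) \<in> start_before J s \<and> s j < s j' + real (proc_time j')}"
    have "finite ?A"
      by (rule finite_subset[OF _ assms]) (auto simp: start_before_def)
    moreover have "j' \<in> ?A" using that by (auto simp: running_def)
    ultimately show ?thesis
      using least_unused_le_card(2)[of ?A j' "color J s"] by (simp add: color_unfold[OF assms, of s j])
  qed
  show ?thesis
  proof (rule inj_onI, rule ccontr)
    fix j j' assume *: "j \<in> running J s t" "j' \<in> running J s t" "color J s j = color J s j'" "j \<noteq> j'"
    then have "code j \<noteq> code j'" using inj_code by (auto dest: injD)
    then have "(j, j') \<in> start_before J s \<or> (j', j) \<in> start_before J s"
      using * by (auto simp: start_before_def running_def)
    then show False using ne[of j j'] ne[of j' j] * by auto
  qed
qed

text \<open>The forbidden colours belong to jobs other than \<open>j\<close> that run when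
  \<open>j\<close> starts, so a bound on simultaneous jobs bounds the colours.\<close>

lemma color_less_card_running:
  assumes "finite J" "j \<in> running J s t"
  shows "color J s j < card (running J s (s j))"
proof -
  let ?A = "{j'. (j', j) \<in> start_before J s \<and> s j < s j' + real (proc_time j')}"
  have fin: "finite (running J s (s j))" using assms(1) by (simp add: running_def)
  have "?A \<subseteq> running J s (s j)"
    by (auto simp: start_before_def running_def)
  moreover have "j \<in> running J s (s j)"
    using assms(2) by (auto simp: running_def)
  moreover have "j \<notin> ?A"
    by (simp add: start_before_def)
  ultimately have "?A \<subset> running J s (s j)" by blast
  then have "finite ?A" "card ?A < card (running J s (s j))"
    using fin finite_subset psubset_card_mono by (blast, blast)
  then show ?thesis
    using least_unused_le_card(1)[of ?A "color J s"] by (simp add: color_unfold[OF assms(1), of s j])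
qed

section \<open>Start times\<close>

definition window :: "job \<Rightarrow> nat" where
  "window j = deadline j - release j"

definition loose :: "job \<Rightarrow> bool" where
  "loose j \<longleftrightarrow> 16 * proc_time j \<le> window j"

text \<open>For windows of length at least 8, this yields
  \<open>4 * scale j \<le> window j < 8 * scale j\<close>, so a window is at least four slots
  long.\<close>

definition level :: "job \<Rightarrow> nat" where
  "level j = (LEAST q. window j < 8 * 2 ^ q)"

definition scale :: "job \<Rightarrow> nat" where
  "scale j = 2 ^ level j"

definition slot :: "job \<Rightarrow> nat" where
  "slot j = release j div scale j"

text \<open>The position of the job in the concatenation of its batch in the order of
  \<open>code\<close>.\<close>

definition offset :: "job set \<Rightarrow> job \<Rightarrow> nat" where
  "offset J j = (\<Sum>j' \<in> {j' \<in> J. level j' = level j \<and> slot j' = slot j \<and> code j' < code j}.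
     proc_time j')"

text \<open>The loose jobs of one level and slot are concatenated, and the concatenation is cut into pieces
  of length \<open>scale j\<close> that are all put into the slot after next, whose start is no earlier than the
  time at which the whole batch is known. The natural subtractions truncate, so that no job
  is started before its release, even on infeasible instances.\<close>

definition start :: "job set \<Rightarrow> job \<Rightarrow> real" where
  "start J j =
     (if loose j then real ((slot j + 2) * scale j + offset J j mod scale j)
      else real (release j) + real (window j - proc_time j) / 2)"

lemma scale_pos: "0 < scale j"
  by (simp add: scale_def)

lemma window_less: "window j < 8 * scale j"
  unfolding scale_def level_def
proof (rule LeastI[of "\<lambda>q. window j < 8 * 2 ^ q"])
  show "window j < 8 * 2 ^ window j"
    using less_exp[of "window j"] by (rule less_le_trans) simp
qed

lemma window_ge:
  assumes "8 \<le> window j"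
  shows "4 * scale j \<le> window j"
proof (cases "level j")
  case 0
  then show ?thesis using window_less[of j] assms by (simp add: scale_def)
next
  case (Suc q)
  then have "\<not> window j < 8 * 2 ^ q"
    using not_less_Least[of q "\<lambda>q. window j < 8 * 2 ^ q"] by (simp add: level_def)
  then show ?thesis by (simp add: scale_def Suc)
qed

lemma slot_bounds:
  "slot j * scale j \<le> release j" "release j < (slot j + 1) * scale j"
proof -
  show "slot j * scale j \<le> release j"
    by (simp add: slot_def)
  show "release j < (slot j + 1) * scale j"
    using dividend_less_div_times[OF scale_pos, of "release j" j] by (simp add: slot_def)
qed

lemma release_le_start: "real (release j) \<le> start J j"
proof (cases "loose j")
  case True
  have "release j \<le> (slot j + 2) * scale j + offset J j mod scale j"
    using slot_bounds(2)[of j] by (simp add: algebra_simps)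
  then show ?thesis using True by (simp add: start_def del: of_nat_add of_nat_mult)
qed (simp add: start_def)

text \<open>Whichever of the two start times is at most \<open>t\<close>, the slot of the batch has
  ended by then, so the whole batch is known and both offsets agree. The second alternative excludes
  premature starts caused by incomplete knowledge.\<close>

lemma start_known_jobs:
  assumes "start J j \<le> t \<or> start (known_jobs J t) j \<le> t"
  shows "start (known_jobs J t) j = start J j"
proof (cases "loose j")
  case True
  have *: "real ((slot j + 1) * scale j) \<le> t"
  proof -
    have "real ((slot j + 1) * scale j) \<le> start K j" for K
      using True by (simp add: start_def algebra_simps)
    from this[of J] this[of "known_jobs J t"] show ?thesis using assms by linarith
  qed
  have "real (release j') \<le> t" if "level j' = level j" "slot j' = slot j" for j'
  proof -
    have "release j' < (slot j + 1) * scale j"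
      using slot_bounds(2)[of j'] that by (simp add: scale_def)
    then have "real (release j') \<le> real ((slot j + 1) * scale j)"
      by (simp only: of_nat_le_iff)
    then show ?thesis using * by linarith
  qed
  then have "offset (known_jobs J t) j = offset J j"
    unfolding offset_def known_jobs_def by (intro sum.cong) auto
  then show ?thesis by (simp add: start_def)
qed (simp add: start_def)

lemma offset_add_le:
  assumes "finite J" "j \<in> J" "level j = level j'" "slot j = slot j'" "code j < code j'"
  shows "offset J j + proc_time j \<le> offset J j'"
proof -
  let ?B = "{k \<in> J. level k = level j \<and> slot k = slot j \<and> code k < code j}"
  have "finite ?B" "j \<notin> ?B" using assms(1) by simp_all
  then have "offset J j + proc_time j = (\<Sum>k\<in>insert j ?B. proc_time k)"
    unfolding offset_def by (subst sum.insert) simp_all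
  also have "\<dots> \<le> offset J j'"
    unfolding offset_def
  proof (rule sum_mono2)
    show "insert j ?B \<subseteq> {k \<in> J. level k = level j' \<and> slot k = slot j' \<and> code k < code j'}"
      using assms(2-5) less_trans by (intro subsetI) (elim insertE, simp_all)
  qed (simp_all add: assms(1))
  finally show ?thesis .
qed

text \<open>\<open>16 p \<le> window < 8 scale\<close> gives the first bound; \<open>p > 0\<close>
  makes the window at least 16, so the truncated subtraction is exact.\<close>

lemma loose_facts:
  assumes "loose j" "0 < proc_time j"
  shows "2 * proc_time j < scale j" "4 * scale j \<le> window j"
    "deadline j = release j + window j"
proof -
  have "16 * proc_time j \<le> window j" "8 \<le> window j"
    using assms by (simp_all add: loose_def)
  then show "2 * proc_time j < scale j" "4 * scale j \<le> window j"
    using window_less[of j] window_ge[of j] by linarith+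
  show "deadline j = release j + window j"
    using \<open>8 \<le> window j\<close> by (simp add: window_def)
qed

section \<open>The number of simultaneously running jobs\<close>

locale feasible_agreeable =
  fixes J :: "job set" and m :: nat and \<sigma> :: schedule
  assumes finite_J: "finite J"
    and agreeable_J: "agreeable J"
    and feas: "preemptive_schedule J {..<m} \<sigma>"
begin

lemma agreeableD:
  "j \<in> J \<Longrightarrow> j' \<in> J \<Longrightarrow> release j < release j' \<Longrightarrow> deadline j \<le> deadline j'"
  using agreeable_J by (auto simp: agreeable_def)

text \<open>Absorbs additive constants into multiples of \<open>m\<close>.\<close>

lemma machines_pos:
  assumes "j \<in> J" "0 < proc_time j"
  shows "0 < m"
  using work_bound[OF feas, of "{j}" "real (release j)" "real (deadline j)"]
    feasible_window[OF feas assms] assms by (cases m) auto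

text \<open>Let \<open>b\<close> be the least distance from \<open>t\<close> to a deadline. By agreeability all releases, hence all
  laxities, are within \<open>O(b)\<close>. So a job with a deadline after \<open>t + 4 b\<close> has to run for \<open>2 b\<close> units
  in \<open>[t, t + 4 b)\<close>, and every other job, being tight, is a job of size at least \<open>b / 16\<close> whose
  window lies in \<open>[t - b, t + 4 b)\<close>.\<close>

lemma card_tight_right:
  assumes "S \<subseteq> J"
    and S: "\<And>j. j \<in> S \<Longrightarrow> real (release j) \<le> t \<and> t < real (deadline j) \<and>
      real (deadline j) - real (release j) \<le> 16 * real (proc_time j) \<and>
      real (deadline j) - real (release j) - real (proc_time j) \<le> 2 * (t - real (release j)) \<and>
      t - real (release j) \<le> real (deadline j) - t"
  shows "real (card S) \<le> 82 * real m"
proof (cases "S = {}")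
  case False
  have "finite S" using \<open>S \<subseteq> J\<close> finite_J finite_subset by blast
  obtain j0 where j0: "j0 \<in> S" "\<And>j. j \<in> S \<Longrightarrow> deadline j0 \<le> deadline j"
    using False ex_has_least_nat[of "\<lambda>j. j \<in> S" _ deadline] by blast
  define b where "b = real (deadline j0) - t"
  have "b > 0" using S[OF j0(1)] by (simp add: b_def)
  have d: "b \<le> real (deadline j) - t" if "j \<in> S" for j
    using j0(2)[OF that] by (simp add: b_def)
  \<comment> \<open>A job released before \<open>j0\<close> has its deadline at \<open>t + b\<close>
    at the latest, and its release is at least as close to \<open>t\<close>; any other job is
    released no earlier than \<open>j0\<close>, which itself satisfies the bound.\<close>
  have r: "t - real (release j) \<le> b" if j: "j \<in> S" for j
  proof (cases "release j < release j0")
    case True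
    then have "deadline j \<le> deadline j0"
      using agreeableD[of j j0] j j0(1) \<open>S \<subseteq> J\<close> by blast
    then have "real (deadline j) \<le> real (deadline j0)" by simp
    then show ?thesis using S[OF j] unfolding b_def by linarith
  next
    case False
    then have "real (release j0) \<le> real (release j)" by simp
    then show ?thesis using S[OF j0(1)] unfolding b_def by linarith
  qed
  define S1 where "S1 = {j \<in> S. 4 * b \<le> real (deadline j) - t}"
  define S2 where "S2 = {j \<in> S. \<not> 4 * b \<le> real (deadline j) - t}"
  have sub: "S1 \<subseteq> J" "S2 \<subseteq> J" "finite S1" "finite S2"
    using \<open>S \<subseteq> J\<close> \<open>finite S\<close> by (auto simp: S1_def S2_def)
  \<comment> \<open>The window covers the whole interval of length \<open>4 b\<close>, and the
    laxity is at most \<open>2 (t - r) \<le> 2 b\<close>.\<close>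
  have "real (card S1) * (2 * b) \<le> real m * ((t + 4 * b) - t)"
  proof (rule card_work_bound[OF feas sub(1,3)])
    fix j assume "j \<in> S1"
    then have "j \<in> S" "4 * b \<le> real (deadline j) - t" by (auto simp: S1_def)
    then show "2 * b \<le> real (proc_time j) - max 0 (t - real (release j))
        - max 0 (real (deadline j) - (t + 4 * b))"
      using S[of j] r[of j] by (simp add: max_def)
  qed (use \<open>b > 0\<close> in simp)
  then have "(2 * b) * real (card S1) \<le> (2 * b) * (2 * real m)"
    by (simp add: algebra_simps)
  then have S1: "real (card S1) \<le> 2 * real m"
    using \<open>b > 0\<close> by simp
  \<comment> \<open>The window has length at least \<open>b\<close>, so tightness gives
    \<open>p \<ge> b / 16\<close>; the interval has length \<open>5 b\<close>, whence 80.\<close>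
  have "real (card S2) * (b / 16) \<le> real m * ((t + 4 * b) - (t - b))"
  proof (rule card_work_bound[OF feas sub(2,4)])
    fix j assume "j \<in> S2"
    then have "j \<in> S" "real (deadline j) - t < 4 * b" by (auto simp: S2_def)
    then show "b / 16 \<le> real (proc_time j) - max 0 (t - b - real (release j))
        - max 0 (real (deadline j) - (t + 4 * b))"
      using S[of j] r[of j] d[of j] by (simp add: max_def)
  qed (use \<open>b > 0\<close> in simp)
  then have "(b / 16) * real (card S2) \<le> (b / 16) * (80 * real m)"
    by (simp add: algebra_simps)
  then have S2: "real (card S2) \<le> 80 * real m"
    using \<open>b > 0\<close> by simp
  have "S = S1 \<union> S2" by (auto simp: S1_def S2_def)
  then have "real (card S) \<le> real (card S1) + real (card S2)"
    using card_Un_le[of S1 S2] by (metis of_nat_add of_nat_le_iff)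
  then show ?thesis using S1 S2 by linarith
qed simp

text \<open>The mirror image: \<open>a\<close> is the distance from \<open>t\<close> back to the
  latest release, and agreeability puts all deadlines within \<open>a\<close> of
  \<open>t\<close>.\<close>

lemma card_tight_left:
  assumes "S \<subseteq> J"
    and S: "\<And>j. j \<in> S \<Longrightarrow> real (release j) \<le> t \<and> t < real (deadline j) \<and>
      real (deadline j) - real (release j) \<le> 16 * real (proc_time j) \<and>
      real (deadline j) - real (release j) - real (proc_time j) \<le> 2 * (real (deadline j) - t) \<and>
      real (deadline j) - t \<le> t - real (release j)"
  shows "real (card S) \<le> 82 * real m"
proof (cases "S = {}")
  case False
  have "finite S" using \<open>S \<subseteq> J\<close> finite_J finite_subset by blast
  have "Max (release ` S) \<in> release ` S"
    using \<open>finite S\<close> False by (intro Max_in) auto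
  then obtain j0 where j0: "j0 \<in> S" "release j0 = Max (release ` S)" by auto
  have max: "release j \<le> release j0" if "j \<in> S" for j
    using \<open>finite S\<close> that by (simp add: j0(2))
  define a where "a = t - real (release j0)"
  have "a > 0" using S[OF j0(1)] by (simp add: a_def)
  have r: "a \<le> t - real (release j)" if "j \<in> S" for j
    using max[OF that] by (simp add: a_def)
  have d: "real (deadline j) - t \<le> a" if j: "j \<in> S" for j
  proof (cases "release j < release j0")
    case True
    then have "deadline j \<le> deadline j0"
      using agreeableD[of j j0] j j0(1) \<open>S \<subseteq> J\<close> by blast
    then have "real (deadline j) \<le> real (deadline j0)" by simp
    then show ?thesis using S[OF j0(1)] unfolding a_def by linarith
  next
    case False
    then have "real (release j0) \<le> real (release j)" by simp
    then show ?thesis using S[OF j] unfolding a_def by linarith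
  qed
  define S1 where "S1 = {j \<in> S. 4 * a \<le> t - real (release j)}"
  define S2 where "S2 = {j \<in> S. \<not> 4 * a \<le> t - real (release j)}"
  have sub: "S1 \<subseteq> J" "S2 \<subseteq> J" "finite S1" "finite S2"
    using \<open>S \<subseteq> J\<close> \<open>finite S\<close> by (auto simp: S1_def S2_def)
  have "real (card S1) * (2 * a) \<le> real m * (t - (t - 4 * a))"
  proof (rule card_work_bound[OF feas sub(1,3)])
    fix j assume "j \<in> S1"
    then have "j \<in> S" "4 * a \<le> t - real (release j)" by (auto simp: S1_def)
    then show "2 * a \<le> real (proc_time j) - max 0 (t - 4 * a - real (release j))
        - max 0 (real (deadline j) - t)"
      using S[of j] d[of j] by (simp add: max_def)
  qed (use \<open>a > 0\<close> in simp)
  then have "(2 * a) * real (card S1) \<le> (2 * a) * (2 * real m)"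
    by (simp add: algebra_simps)
  then have S1: "real (card S1) \<le> 2 * real m"
    using \<open>a > 0\<close> by simp
  have "real (card S2) * (a / 16) \<le> real m * ((t + a) - (t - 4 * a))"
  proof (rule card_work_bound[OF feas sub(2,4)])
    fix j assume "j \<in> S2"
    then have "j \<in> S" "t - real (release j) < 4 * a" by (auto simp: S2_def)
    then show "a / 16 \<le> real (proc_time j) - max 0 (t - 4 * a - real (release j))
        - max 0 (real (deadline j) - (t + a))"
      using S[of j] r[of j] d[of j] by (simp add: max_def)
  qed (use \<open>a > 0\<close> in simp)
  then have "(a / 16) * real (card S2) \<le> (a / 16) * (80 * real m)"
    by (simp add: algebra_simps)
  then have S2: "real (card S2) \<le> 80 * real m"
    using \<open>a > 0\<close> by simp
  have "S = S1 \<union> S2" by (auto simp: S1_def S2_def)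
  then have "real (card S) \<le> real (card S1) + real (card S2)"
    using card_Un_le[of S1 S2] by (metis of_nat_add of_nat_le_iff)
  then show ?thesis using S1 S2 by linarith
qed simp

text \<open>A job run in the middle of its window has half its laxity on either side, so
  \<open>t\<close> is at least that far from both ends. The cases differ in which end is
  nearer.\<close>

lemma card_running_tight:
  "real (card {j \<in> running J (start J) t. \<not> loose j}) \<le> 164 * real m"
proof -
  let ?S = "{j \<in> running J (start J) t. \<not> loose j}"
  define R where "R = {j \<in> ?S. t - real (release j) \<le> real (deadline j) - t}"
  define L where "L = {j \<in> ?S. real (deadline j) - t \<le> t - real (release j)}"
  have S: "j \<in> J" "real (release j) \<le> t" "t < real (deadline j)"
      "real (deadline j) - real (release j) \<le> 16 * real (proc_time j)"
      "real (deadline j) - real (release j) - real (proc_time j) \<le> 2 * (t - real (release j))"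
      "real (deadline j) - real (release j) - real (proc_time j) \<le> 2 * (real (deadline j) - t)"
    if "j \<in> ?S" for j
  proof -
    have j: "j \<in> J" "start J j \<le> t" "t < start J j + real (proc_time j)" "\<not> loose j"
      using that by (auto simp: running_def)
    then have "0 < proc_time j" by (cases "proc_time j") auto
    then have "release j + proc_time j \<le> deadline j"
      using feasible_window[OF feas] j by blast
    then have s: "start J j = real (release j)
        + (real (deadline j) - real (release j) - real (proc_time j)) / 2"
      and l: "real (deadline j) - real (release j) \<le> 16 * real (proc_time j)"
      and "real (release j) + real (proc_time j) \<le> real (deadline j)"
      using j(4) by (auto simp: start_def window_def of_nat_diff loose_def)
    then show "j \<in> J" "real (release j) \<le> t" "t < real (deadline j)"
      "real (deadline j) - real (release j) \<le> 16 * real (proc_time j)"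
      "real (deadline j) - real (release j) - real (proc_time j) \<le> 2 * (t - real (release j))"
      "real (deadline j) - real (release j) - real (proc_time j) \<le> 2 * (real (deadline j) - t)"
      using j(1) j(2,3)[unfolded s] by (simp_all add: field_simps)
  qed
  have "real (card R) \<le> 82 * real m"
    by (rule card_tight_right[of R t]) (use S in \<open>auto simp: R_def\<close>)
  moreover have "real (card L) \<le> 82 * real m"
    by (rule card_tight_left[of L t]) (use S in \<open>auto simp: L_def\<close>)
  moreover have "?S = R \<union> L" by (auto simp: R_def L_def)
  then have "real (card ?S) \<le> real (card R) + real (card L)"
    using card_Un_le[of R L] by (metis of_nat_add of_nat_le_iff)
  ultimately show ?thesis by linarith
qed

text \<open>A batch is released within one slot and its windows are shorter than eight slots, so all
  its work lies in an interval of nine slots.\<close>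

lemma offset_div_le: "offset J j div scale j \<le> 9 * m"
proof -
  let ?B = "{k \<in> J. level k = level j \<and> slot k = slot j \<and> code k < code j}"
  let ?x = "real (slot j * scale j)" and ?W = "real (scale j)"
  have k: "max 0 (?x - real (release k)) = 0" "max 0 (real (deadline k) - (?x + 9 * ?W)) = 0"
    if "k \<in> ?B" for k
  proof -
    have "slot j * scale j \<le> release k" "release k < (slot j + 1) * scale j"
      "window k < 8 * scale j"
      using that slot_bounds[of k] window_less[of k] by (auto simp: scale_def)
    moreover have "deadline k \<le> release k + window k" by (simp add: window_def)
    ultimately have "slot j * scale j \<le> release k"
      "deadline k \<le> slot j * scale j + 9 * scale j"
      by auto
    then have "real (slot j * scale j) \<le> real (release k)"
      "real (deadline k) \<le> real (slot j * scale j + 9 * scale j)"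
      by (simp_all only: of_nat_le_iff)
    then show "max 0 (?x - real (release k)) = 0" "max 0 (real (deadline k) - (?x + 9 * ?W)) = 0"
      by auto
  qed
  have "real (offset J j) = (\<Sum>k\<in>?B. real (proc_time k) - max 0 (?x - real (release k))
      - max 0 (real (deadline k) - (?x + 9 * ?W)))"
    unfolding offset_def of_nat_sum by (rule sum.cong) (use k in auto)
  also have "\<dots> \<le> real m * ((?x + 9 * ?W) - ?x)"
    using finite_J by (intro work_bound[OF feas]) auto
  also have "\<dots> = real (9 * m * scale j)" by simp
  finally have "offset J j \<le> 9 * m * scale j" by (simp only: of_nat_le_iff)
  then have "offset J j div scale j \<le> 9 * m * scale j div scale j" by (rule div_le_mono)
  then show ?thesis using scale_pos[of j] by simp
qed

text \<open>Loose jobs running at the same time have at most five consecutive levels and, within a level, at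
  most two consecutive slots, which the parity distinguishes. Within a batch, jobs in the same
  piece of the concatenation do not overlap.\<close>

lemma card_running_loose:
  "card {j \<in> running J (start J) t. loose j} \<le> 100 * m"
proof (cases "{j \<in> running J (start J) t. loose j} = {}")
  case False
  let ?S = "{j \<in> running J (start J) t. loose j}"
  have p: "0 < proc_time j" if "j \<in> ?S" for j
    using that by (cases "proc_time j") (auto simp: running_def)
  have lo: "real (slot j + 2) * real (scale j) \<le> t"
    and hi: "t < real (slot j + 3) * real (scale j) + real (scale j) / 2"
    and at: "real (offset J j mod scale j) \<le> t - real (slot j + 2) * real (scale j)"
      "t - real (slot j + 2) * real (scale j) < real (offset J j mod scale j) + real (proc_time j)"
    if "j \<in> ?S" for j
  proof -
    have s: "start J j = real (slot j + 2) * real (scale j) + real (offset J j mod scale j)"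
      using that by (simp add: start_def algebra_simps)
    have "start J j \<le> t" "t < start J j + real (proc_time j)"
      using that by (auto simp: running_def)
    moreover have "real (offset J j mod scale j) < real (scale j)"
      using scale_pos[of j] by simp
    moreover have "2 * real (proc_time j) < real (scale j)"
      using loose_facts(1)[of j] p[OF that] that by simp
    moreover have "real (slot j + 3) * real (scale j)
        = real (slot j + 2) * real (scale j) + real (scale j)"
      by (simp add: algebra_simps)
    ultimately show "real (slot j + 2) * real (scale j) \<le> t"
      "t < real (slot j + 3) * real (scale j) + real (scale j) / 2"
      "real (offset J j mod scale j) \<le> t - real (slot j + 2) * real (scale j)"
      "t - real (slot j + 2) * real (scale j) < real (offset J j mod scale j) + real (proc_time j)"
      unfolding s using of_nat_0_le_iff[of "offset J j mod scale j"] by linarith+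
  qed
  \<comment> \<open>With \<open>W = scale j\<close>, the release lies in slot \<open>slot j\<close>
    and \<open>t\<close> between \<open>(slot j + 2) W\<close> and
    \<open>(slot j + 3) W + W / 2\<close>; the window length lies between \<open>4 W\<close> and
    \<open>8 W\<close>.\<close>
  have dist: "real (scale j) < t - real (release j)" "real (scale j) / 2 < real (deadline j) - t"
      "t - real (release j) < 4 * real (scale j)" "real (deadline j) - t < 7 * real (scale j)"
    if "j \<in> ?S" for j
  proof -
    have "slot j * scale j \<le> release j" "release j < (slot j + 1) * scale j"
      "4 * scale j \<le> window j" "window j < 8 * scale j" "deadline j = release j + window j"
      using slot_bounds[of j] window_less[of j] loose_facts[of j] p[OF that] that by auto
    then have "real (slot j * scale j) \<le> real (release j)"
      "real (release j) < real ((slot j + 1) * scale j)"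
      "real (4 * scale j) \<le> real (window j)" "real (window j) < real (8 * scale j)"
      "real (deadline j) = real (release j + window j)"
      by (simp_all only: of_nat_le_iff of_nat_less_iff)
    then show "real (scale j) < t - real (release j)" "real (scale j) / 2 < real (deadline j) - t"
      "t - real (release j) < 4 * real (scale j)" "real (deadline j) - t < 7 * real (scale j)"
      using lo[OF that] hi[OF that] by (simp_all add: algebra_simps)
  qed
  obtain j0 where j0: "j0 \<in> ?S" "\<And>j. j \<in> ?S \<Longrightarrow> level j0 \<le> level j"
    using False ex_has_least_nat[of "\<lambda>j. j \<in> ?S" _ level] by blast
  \<comment> \<open>Five levels up, the scale is 32 times as large: \<open>j\<close> would be
    released before \<open>j0\<close> and yet be due after it.\<close>
  have lev: "level j \<le> level j0 + 4" if j: "j \<in> ?S" for j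
  proof (rule ccontr)
    assume "\<not> level j \<le> level j0 + 4"
    then have "(2::nat) ^ (level j0 + 5) \<le> 2 ^ level j"
      by (intro power_increasing) auto
    then have "32 * scale j0 \<le> scale j" by (simp add: scale_def power_add)
    then have big: "32 * real (scale j0) \<le> real (scale j)" by linarith
    then have "real (release j) < real (release j0)"
      using dist[OF j] dist[OF j0(1)] by linarith
    then have "deadline j \<le> deadline j0"
      using agreeableD[of j j0] j j0(1) by (auto simp: running_def)
    then have "real (deadline j) \<le> real (deadline j0)" by simp
    then show False
      using big dist[OF j] dist[OF j0(1)] by linarith
  qed
  define f where "f j = (level j, slot j mod 2, offset J j div scale j)" for j
  have "inj_on f ?S"
  proof (rule inj_onI, rule ccontr)
    fix j j' assume j: "j \<in> ?S" "j' \<in> ?S" "f j = f j'" "j \<noteq> j'"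
    have sc: "scale j = scale j'" using j(3) by (simp add: f_def scale_def)
    \<comment> \<open>Two slots further on, \<open>k\<close> starts no earlier than
      \<open>(slot k' + 4) W\<close>, when \<open>k'\<close> is already over.\<close>
    have near: "slot k < slot k' + 2" if "k \<in> ?S" "k' \<in> ?S" "scale k = scale k'" for k k'
    proof (rule ccontr)
      assume "\<not> slot k < slot k' + 2"
      then have "real (slot k' + 4) * real (scale k') \<le> real (slot k + 2) * real (scale k')"
        by (intro mult_right_mono) auto
      then show False
        using lo[OF that(1)] hi[OF that(2)] scale_pos[of k'] that(3) by (simp add: algebra_simps)
    qed
    have "slot j < slot j' + 2" "slot j' < slot j + 2" "slot j mod 2 = slot j' mod 2"
      using near j sc by (auto simp: f_def)
    then have sl: "slot j = slot j'" by presburger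
    \<comment> \<open>Equal quotients turn the order of the offsets into one of the remainders, so
      \<open>k\<close> ends before \<open>k'\<close> starts.\<close>
    have order: False
      if k: "k \<in> ?S" "k' \<in> ?S" "level k = level k'" "slot k = slot k'" "scale k = scale k'"
        "offset J k div scale k = offset J k' div scale k'" "code k < code k'" for k k'
    proof -
      have "offset J k + proc_time k \<le> offset J k'"
        using offset_add_le[OF finite_J] k by (auto simp: running_def)
      moreover have "offset J k = offset J k' div scale k' * scale k' + offset J k mod scale k"
        using div_mult_mod_eq[of "offset J k" "scale k"] k(5,6) by metis
      moreover have "offset J k' = offset J k' div scale k' * scale k' + offset J k' mod scale k'"
        by simp
      ultimately have "offset J k mod scale k + proc_time k \<le> offset J k' mod scale k'"
        by linarith
      then have "real (offset J k mod scale k + proc_time k) \<le> real (offset J k' mod scale k')"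
        by (simp only: of_nat_le_iff)
      then show False
        using at(2)[OF k(1)] at(1)[OF k(2)] k(4,5) by simp
    qed
    have "code j \<noteq> code j'" using inj_code j(4) by (auto dest: injD)
    then consider "code j < code j'" | "code j' < code j" by linarith
    then show False
      using order[OF j(1,2)] order[OF j(2,1)] j(3) sc sl by cases (simp_all add: f_def)
  qed
  moreover have "f ` ?S \<subseteq> {level j0..level j0 + 4} \<times> {..<2} \<times> {..9 * m}"
    using lev j0(2) offset_div_le by (auto simp: f_def)
  ultimately have "card ?S \<le> card ({level j0..level j0 + 4} \<times> {..<2::nat} \<times> {..9 * m})"
    by (intro card_inj_on_le) auto
  also have "\<dots> = 90 * m + 10" by simp
  also have "\<dots> \<le> 100 * m"
    using machines_pos[of j0] p[OF j0(1)] j0(1) by (simp add: running_def)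
  finally show ?thesis .
next
  case True
  show ?thesis unfolding True by simp
qed

lemma card_running: "card (running J (start J) t) \<le> 264 * m"
proof -
  let ?R = "running J (start J) t"
  have "?R = {j \<in> ?R. \<not> loose j} \<union> {j \<in> ?R. loose j}" by auto
  then have "card ?R \<le> card {j \<in> ?R. \<not> loose j} + card {j \<in> ?R. loose j}"
    by (metis card_Un_le)
  moreover have "card {j \<in> ?R. \<not> loose j} \<le> 164 * m"
    using card_running_tight[of t] by linarith
  ultimately show ?thesis using card_running_loose[of t] by linarith
qed

lemma start_window:
  assumes "j \<in> J" "0 < proc_time j"
  shows "start J j + real (proc_time j) \<le> real (deadline j)"
proof (cases "loose j")
  case True
  have "offset J j mod scale j < scale j" using scale_pos by simp
  moreover have "(slot j + 2) * scale j = slot j * scale j + 2 * scale j"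
    by (simp add: algebra_simps)
  ultimately have "(slot j + 2) * scale j + offset J j mod scale j + proc_time j \<le> deadline j"
    using loose_facts[OF True assms(2)] slot_bounds(1)[of j] by linarith
  then have "real ((slot j + 2) * scale j + offset J j mod scale j + proc_time j)
      \<le> real (deadline j)"
    by (simp only: of_nat_le_iff)
  then show ?thesis using True by (simp add: start_def)
next
  case False
  have "release j + proc_time j \<le> deadline j"
    by (rule feasible_window[OF feas assms])
  then show ?thesis
    using False by (simp add: start_def window_def of_nat_diff field_simps)
qed

end

section \<open>The online algorithm\<close>

text \<open>Only these jobs are coloured: the start times computed for other known jobs may still
  change as jobs arrive.\<close>

definition started :: "job set \<Rightarrow> real \<Rightarrow> job set" where
  "started J t = {j \<in> J. start J j \<le> t}"

definition algorithm :: online_algorithm where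
  "algorithm K t =
     (let R = running K (start K) t; c = color (started K t) (start K)
      in (c ` R, \<lambda>i. if \<exists>j\<in>R. c j = i then Some (THE j. j \<in> R \<and> c j = i) else None))"

text \<open>A running job has been released, hence is known, and both directions of
  \<open>start_known_jobs\<close> apply.\<close>

lemma running_known_jobs:
  "running (known_jobs J t) (start (known_jobs J t)) t = running J (start J) t"
proof (rule set_eqI)
  fix j
  show "j \<in> running (known_jobs J t) (start (known_jobs J t)) t \<longleftrightarrow> j \<in> running J (start J) t"
    using start_known_jobs[of J j t] order_trans[OF release_le_start[of j J], of t]
    unfolding running_def known_jobs_def by (smt (verit) mem_Collect_eq)
qed

lemma started_known_jobs: "started (known_jobs J t) t = {j \<in> J. start J j \<le> t}"
proof (rule set_eqI)
  fix j
  show "j \<in> started (known_jobs J t) t \<longleftrightarrow> j \<in> {j \<in> J. start J j \<le> t}"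
    using start_known_jobs[of J j t] order_trans[OF release_le_start[of j J], of t]
    unfolding started_def known_jobs_def by (smt (verit) mem_Collect_eq)
qed

lemma color_known_jobs:
  assumes "finite J" "j \<in> running J (start J) t"
  shows "color (started (known_jobs J t) t) (start (known_jobs J t)) j = color J (start J) j"
proof (rule color_cong[OF assms(1) started_known_jobs])
  show "start (known_jobs J t) j' = start J j'" if "j' \<in> started (known_jobs J t) t" for j'
    using that start_known_jobs[of J j' t] unfolding started_known_jobs by blast
  show "j \<in> started (known_jobs J t) t"
    using assms(2) by (simp add: started_known_jobs running_def)
qed

lemma fst_algorithm:
  assumes "finite J"
  shows "fst (algorithm (known_jobs J t) t) = color J (start J) ` running J (start J) t"
  using color_known_jobs[OF assms]
  by (auto simp: algorithm_def Let_def running_known_jobs image_iff)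

lemma schedule_of_algorithm:
  assumes "finite J"
  shows "schedule_of algorithm J i t = Some j \<longleftrightarrow>
    j \<in> running J (start J) t \<and> color J (start J) j = i"
proof -
  let ?R = "running J (start J) t" and ?c = "color J (start J)"
  have R: "(k \<in> ?R \<and> color (started (known_jobs J t) t) (start (known_jobs J t)) k = i)
      \<longleftrightarrow> (k \<in> ?R \<and> ?c k = i)" for k
    using color_known_jobs[OF assms] by auto
  have "schedule_of algorithm J i t =
      (if \<exists>k. k \<in> ?R \<and> ?c k = i then Some (THE k. k \<in> ?R \<and> ?c k = i) else None)"
    by (simp add: schedule_of_def algorithm_def Let_def running_known_jobs Bex_def R)
  \<comment> \<open>Running jobs have distinct colours, so the description is unique.\<close>
  moreover have "(THE k. k \<in> ?R \<and> ?c k = i) = k" if "k \<in> ?R" "?c k = i" for k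
    using that color_inj_on_running[OF assms, of "start J" t] by (auto dest: inj_onD)
  ultimately show ?thesis by auto
qed

section \<open>Feasibility and cost of the online schedule\<close>

context feasible_agreeable
begin

lemma all_opened_algorithm: "all_opened algorithm J \<subseteq> {..<264 * m}"
proof -
  have "color J (start J) j < 264 * m" if "j \<in> running J (start J) t" for j t
    using color_less_card_running[OF finite_J that] card_running[of "start J j"] by linarith
  then show ?thesis
    by (auto simp: all_opened_def open_machines_def fst_algorithm[OF finite_J])
qed

lemma schedule_of_algorithm_open:
  "schedule_of algorithm J i t \<noteq> None \<Longrightarrow> i \<in> open_machines algorithm J t"
  by (auto simp: open_machines_def fst_algorithm[OF finite_J] schedule_of_algorithm[OF finite_J])

lemma nonpreemptive_algorithm:
  "nonpreemptive_schedule J (all_opened algorithm J) (schedule_of algorithm J)"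
proof -
  let ?\<sigma> = "schedule_of algorithm J" and ?c = "color J (start J)"
  have \<sigma>: "?\<sigma> i t = Some j \<longleftrightarrow>
      j \<in> J \<and> start J j \<le> t \<and> t < start J j + real (proc_time j) \<and> ?c j = i" for i t j
    by (auto simp: schedule_of_algorithm[OF finite_J] running_def)
  have P: "processing_times ?\<sigma> j = {start J j..<start J j + real (proc_time j)}"
    if "j \<in> J" for j
    using that by (auto simp: processing_times_def \<sigma>)
  have "preemptive_schedule J (all_opened algorithm J) ?\<sigma>"
    unfolding preemptive_schedule_def
  proof (intro conjI allI ballI impI)
    fix i t j assume "?\<sigma> i t = Some j"
    then show "i \<in> all_opened algorithm J" "j \<in> J"
      using schedule_of_algorithm_open[of i t] by (auto simp: all_opened_def \<sigma>)
  next
    fix i i' t j assume "?\<sigma> i t = Some j \<and> ?\<sigma> i' t = Some j"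
    then show "i = i'" by (simp add: \<sigma>)
  next
    fix j assume j: "j \<in> J"
    show "processing_times ?\<sigma> j \<subseteq> {real (release j)..<real (deadline j)}"
    \<comment> \<open>A job without work occupies the empty set, whatever its window;
      \<open>start_window\<close> covers positive processing times.\<close>
    proof (cases "proc_time j = 0")
      case False
      then show ?thesis
        unfolding P[OF j] using start_window[OF j] release_le_start[of j J] by auto
    qed (simp add: P[OF j])
    show "measure lborel (processing_times ?\<sigma> j) = real (proc_time j)"
      by (simp add: P[OF j])
  next
    fix i j assume j: "j \<in> J"
    let ?F = "if ?c j = i then {(start J j, start J j + real (proc_time j))} else {}"
    have "{t. ?\<sigma> i t = Some j} = (\<Union>(a, b)\<in>?F. {a..<b})"
      using j by (auto simp: \<sigma>)
    moreover have "finite ?F" by simp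
    ultimately show "\<exists>F. finite F \<and> {t. ?\<sigma> i t = Some j} = (\<Union>(a, b)\<in>F. {a..<b})"
      by blast
  qed
  moreover have "\<exists>i s. \<forall>i' t. ?\<sigma> i' t = Some j \<longleftrightarrow> i' = i \<and> s \<le> t \<and> t < s + real (proc_time j)"
    if "j \<in> J" for j
    by (rule exI[of _ "?c j"], rule exI[of _ "start J j"]) (use that in \<open>auto simp: \<sigma>\<close>)
  ultimately show ?thesis
    unfolding nonpreemptive_schedule_def by blast
qed

end

theorem theorem4:
  "\<exists>C::real.
     (\<exists>A. competitive_on preemptive_schedule {J. finite J \<and> agreeable J} C A) \<and>
     (\<exists>A. competitive_on nonpreemptive_schedule {J. finite J \<and> agreeable J} C A)"
proof -
  have alg: "nonpreemptive_schedule J (all_opened algorithm J) (schedule_of algorithm J) \<and>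
      (\<forall>i t. schedule_of algorithm J i t \<noteq> None \<longrightarrow> i \<in> open_machines algorithm J t) \<and>
      finite (all_opened algorithm J) \<and> real (card (all_opened algorithm J)) \<le> 264 * real m"
    if "finite J" "agreeable J" "preemptive_schedule J {..<m} \<sigma>" for J m \<sigma>
  proof -
    interpret feasible_agreeable J m \<sigma> by standard (fact that)+
    have "card (all_opened algorithm J) \<le> 264 * m"
      using card_mono[OF _ all_opened_algorithm] by simp
    then have "real (card (all_opened algorithm J)) \<le> 264 * real m" by linarith
    then show ?thesis
      using nonpreemptive_algorithm schedule_of_algorithm_open
        finite_subset[OF all_opened_algorithm] by blast
  qed
  \<comment> \<open>Weakens the hypothesis in the non-preemptive case and the conclusion in the
    preemptive one.\<close>
  have pre: "preemptive_schedule J M \<sigma>" if "nonpreemptive_schedule J M \<sigma>" for J M \<sigma>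
    using that by (simp add: nonpreemptive_schedule_def)
  have "competitive_on preemptive_schedule {J. finite J \<and> agreeable J} 264 algorithm"
    unfolding competitive_on_def
  proof (intro ballI allI impI, elim exE)
    fix J m \<sigma> assume "J \<in> {J. finite J \<and> agreeable J}" "preemptive_schedule J {..<m} \<sigma>"
    with alg[of J m \<sigma>] show "preemptive_schedule J (all_opened algorithm J) (schedule_of algorithm J) \<and>
      (\<forall>i t. schedule_of algorithm J i t \<noteq> None \<longrightarrow> i \<in> open_machines algorithm J t) \<and>
      finite (all_opened algorithm J) \<and> real (card (all_opened algorithm J)) \<le> 264 * real m"
      using pre by blast
  qed
  moreover have "competitive_on nonpreemptive_schedule {J. finite J \<and> agreeable J} 264 algorithm"
    unfolding competitive_on_def
  proof (intro ballI allI impI, elim exE)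
    fix J m \<sigma> assume "J \<in> {J. finite J \<and> agreeable J}" "nonpreemptive_schedule J {..<m} \<sigma>"
    with alg[of J m \<sigma>] pre
    show "nonpreemptive_schedule J (all_opened algorithm J) (schedule_of algorithm J) \<and>
      (\<forall>i t. schedule_of algorithm J i t \<noteq> None \<longrightarrow> i \<in> open_machines algorithm J t) \<and>
      finite (all_opened algorithm J) \<and> real (card (all_opened algorithm J)) \<le> 264 * real m"
      by blast
  qed
  ultimately show ?thesis by blast
qed

end
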